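(* Let $n\ge 1$ and $\theta\in\mathbb{R}$, $\theta\neq 0$. Let $\mathcal{L}_{++}^{n}$ be the Cholesky manifold endowed with the Diagonal Power Metric $g=g^{\theta\text{-DE}}$ (defined in the context). Let $L,K\in\mathcal{L}_{++}^{n}$, $X,Y\in T_L\mathcal{L}_{++}^{n}$, and let $L_1,\dots,L_N\in\mathcal{L}_{++}^{n}$ with weights $w_1,\dots,w_N>0$, $\sum_{i=1}^N w_i=1$. Then: 1. (metric) $g_L(X,Y)=\langle\lfloor X\rfloor,\lfloor Y\rfloor\rangle+\langle\mathbb{L}^{\theta-1}\mathbb{X},\mathbb{L}^{\theta-1}\mathbb{Y}\rangle$; 2. (geodesic) the geodesic starting at $L$ with initial velocity $X$ is $\gamma_{(L,X)}(t)=\lfloor L\rfloor+t\lfloor X\rfloor+\mathbb{L}\left(I+t\theta\,\mathbb{L}^{-1}\mathbb{X}\right)^{1/\theta}$, locally defined for $t\in\{t\in\mathbb{R}\mid \mathbb{L}+t\theta\mathbb{X}\in\mathbb{D}_{++}^{n}\}$; 3. (Riemannian logarithm) $\operatorname{Log}_L(K)=\lfloor K\rfloor-\lfloor L\rfloor+\frac1\theta\mathbb{L}\left[(\mathbb{L}^{-1}\mathbb{K})^{\theta}-I\right]$; 4. (parallel transport along the geodesic connecting $L$ and $K$) $\operatorname{PT}_{L\to K}(X)=\lfloor X\rfloor+(\mathbb{L}^{-1}\mathbb{K})^{1-\theta}\mathbb{X}$; 5. (geodesic distance) $\operatorname{d}^2(L,K)=\|\lfloor K\rfloor-\lfloor L\rfloor\|_{\mathrm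 F}^2+\frac{1}{\theta^2}\|\mathbb{K}^\theta-\mathbb{L}^\theta\|_{\mathrm F}^2$; 6. (weighted Fréchet mean) $\operatorname{WFM}(\{w_i\},\{L_i\})=\sum_i w_i\lfloor L_i\rfloor+\left(\sum_i w_i\mathbb{L}_i^\theta\right)^{1/\theta}$.
   Context: $\mathcal{L}_{++}^{n}$ (the Cholesky manifold) is the set of real $n\times n$ lower triangular matrices with positive diagonal entries, an open submanifold of the Euclidean space $\mathcal{L}^n$ of lower triangular matrices; so $T_L\mathcal{L}_{++}^{n}\cong\mathcal{L}^n$. $\mathbb{D}_{++}^{n}$ is the set of $n\times n$ diagonal matrices with positive diagonal entries. For a square matrix $A$, $\lfloor A\rfloor$ is its strictly lower triangular part, and the blackboard-bold letter $\mathbb{A}$ denotes the diagonal matrix with the diagonal entries of $A$ (so $\mathbb{L},\mathbb{K},\mathbb{X},\mathbb{Y},\mathbb{L}_i$ come from $L,K,X,Y,L_i$). Powers of positive diagonal matrices are taken entrywise on the diagonal. $\langle\cdot,\cdot\rangle$ and $\|\cdot\|_{\mathrm F}$ are the Frobenius inner product and norm. On $\mathbb{R}_{++}=(0,\infty)$ the $\theta$-power-Euclidean metric is $g^{\theta\text{-E}}_p(v,w)=\frac{1}{\theta^2}(\operatorname{Pow}_{\theta})_{*,p}(v)\,(\operatorname{Pow}_{\theta})_{*,p}(w)$, where $\operatorname{Pow}_\theta(p)=p^\theta$ and $(\cdot)_{*,p}$ is the differential at $p$. The Diagonal Power Metric ($\theta$-DPM) $g^{\theta\text{-DE}}$ on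 $\mathcal{L}_{++}^{n}$ is the product metric of the standard Euclidean metric on strictly lower triangular matrices and $n$ copies of $(\mathbb{R}_{++},g^{\theta\text{-E}})$ (one per diagonal entry): $g_L(X,Y)=\langle\lfloor X\rfloor,\lfloor Y\rfloor\rangle+\sum_{i=1}^n g^{\theta\text{-E}}_{L_{ii}}(X_{ii},Y_{ii})$. $\operatorname{WFM}(\{w_i\},\{L_i\})$ is the minimizer over $P\in\mathcal{L}_{++}^{n}$ of $\sum_i w_i\operatorname{d}^2(P,L_i)$, with $\operatorname{d}$ the geodesic distance of $g$. *)

theory Defs
  imports "HOL-Analysis.Analysis"
begin

section \<open>Riemannian geometry in a global chart\<close>

text \<open>
  A manifold is represented by a subset \<open>M\<close> of a Euclidean space that is relatively open in
  a linear subspace \<open>V\<close>. All tangent spaces are then identified with \<open>V\<close>, and a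
  Riemannian metric is a function \<open>g\<close> such that \<open>g p\<close> is an inner product on \<open>V\<close> for every
  \<open>p \<in> M\<close>.

  An affine connection has the form \<open>\<nabla>\<^sub>X Y = D\<^sub>X Y + \<Gamma>(X, Y)\<close> with \<open>\<Gamma> p\<close> bilinear, where \<open>D\<close> is the
  flat directional derivative of the ambient space. Since all terms involved are tensorial, it
  suffices to state torsion-freeness (symmetry of \<open>\<Gamma>\<close>) and metric compatibility
  for constant vector fields.
\<close>

definition is_levi_civita ::
  "'a::euclidean_space set \<Rightarrow> 'a set \<Rightarrow> ('a \<Rightarrow> 'a \<Rightarrow> 'a \<Rightarrow> real) \<Rightarrow> ('a \<Rightarrow> 'a \<Rightarrow> 'a \<Rightarrow> 'a) \<Rightarrow> bool"
where
  "is_levi_civita V M g \<Gamma> \<longleftrightarrow>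
     (\<forall>p\<in>M. bilinear (\<Gamma> p) \<and>
        (\<forall>v\<in>V. \<forall>w\<in>V. \<Gamma> p v w \<in> V \<and> \<Gamma> p v w = \<Gamma> p w v) \<and>
        (\<forall>z\<in>V. \<forall>v\<in>V. \<forall>w\<in>V.
           ((\<lambda>t. g (p + t *\<^sub>R z) v w) has_real_derivative
              g p (\<Gamma> p z v) w + g p v (\<Gamma> p z w)) (at 0)))"

text \<open>By the fundamental theorem of Riemannian geometry, \<open>levi_civita V M g p v w\<close> is determined
  for \<open>p \<in> M\<close> and \<open>v, w \<in> V\<close>; it is only ever used there.\<close>

definition levi_civita ::
  "'a::euclidean_space set \<Rightarrow> 'a set \<Rightarrow> ('a \<Rightarrow> 'a \<Rightarrow> 'a \<Rightarrow> real) \<Rightarrow> ('a \<Rightarrow> 'a \<Rightarrow> 'a \<Rightarrow> 'a)" where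
  "levi_civita V M g = (SOME \<Gamma>. is_levi_civita V M g \<Gamma>)"

text \<open>\<open>W\<close> is a parallel vector field along the curve \<open>c\<close> on the interval \<open>I\<close>: its covariant
  derivative \<open>W' + \<Gamma>(c', W)\<close> vanishes.\<close>

definition parallel_along ::
  "'a::euclidean_space set \<Rightarrow> 'a set \<Rightarrow> ('a \<Rightarrow> 'a \<Rightarrow> 'a \<Rightarrow> real) \<Rightarrow> real set \<Rightarrow>
     (real \<Rightarrow> 'a) \<Rightarrow> (real \<Rightarrow> 'a) \<Rightarrow> bool"
where
  "parallel_along V M g I c W \<longleftrightarrow>
     (\<forall>t\<in>I. c t \<in> M \<and> W t \<in> V \<and>
        (\<exists>c' W'. (c has_vector_derivative c') (at t within I) \<and>
                 (W has_vector_derivative W') (at t within I) \<and>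
                 W' + levi_civita V M g (c t) c' (W t) = 0))"

definition geodesic_on ::
  "'a::euclidean_space set \<Rightarrow> 'a set \<Rightarrow> ('a \<Rightarrow> 'a \<Rightarrow> 'a \<Rightarrow> real) \<Rightarrow> real set \<Rightarrow> (real \<Rightarrow> 'a) \<Rightarrow> bool"
where
  "geodesic_on V M g I c \<longleftrightarrow>
     (\<exists>c'. (\<forall>t\<in>I. (c has_vector_derivative c' t) (at t within I)) \<and> parallel_along V M g I c c')"

definition geodesic_from ::
  "'a::euclidean_space set \<Rightarrow> 'a set \<Rightarrow> ('a \<Rightarrow> 'a \<Rightarrow> 'a \<Rightarrow> real) \<Rightarrow> 'a \<Rightarrow> 'a \<Rightarrow>
     real set \<Rightarrow> (real \<Rightarrow> 'a) \<Rightarrow> bool"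
where
  "geodesic_from V M g p v I c \<longleftrightarrow>
     open I \<and> is_interval I \<and> 0 \<in> I \<and> geodesic_on V M g I c \<and>
     c 0 = p \<and> (c has_vector_derivative v) (at 0)"

text \<open>The geodesic with initial point \<open>p\<close> and initial velocity \<open>v\<close>, on its maximal interval of
  definition \<open>I\<close>: every geodesic with the same initial data is a restriction of it.\<close>

definition maximal_geodesic ::
  "'a::euclidean_space set \<Rightarrow> 'a set \<Rightarrow> ('a \<Rightarrow> 'a \<Rightarrow> 'a \<Rightarrow> real) \<Rightarrow> 'a \<Rightarrow> 'a \<Rightarrow>
     real set \<Rightarrow> (real \<Rightarrow> 'a) \<Rightarrow> bool"
where
  "maximal_geodesic V M g p v I c \<longleftrightarrow>
     geodesic_from V M g p v I c \<and>
     (\<forall>I' c'. geodesic_from V M g p v I' c' \<longrightarrow> I' \<subseteq> I \<and> (\<forall>t\<in>I'. c' t = c t))"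

definition exp_domain ::
  "'a::euclidean_space set \<Rightarrow> 'a set \<Rightarrow> ('a \<Rightarrow> 'a \<Rightarrow> 'a \<Rightarrow> real) \<Rightarrow> 'a \<Rightarrow> 'a set"
where
  "exp_domain V M g p = {v \<in> V. \<exists>I c. maximal_geodesic V M g p v I c \<and> 1 \<in> I}"

definition riem_exp ::
  "'a::euclidean_space set \<Rightarrow> 'a set \<Rightarrow> ('a \<Rightarrow> 'a \<Rightarrow> 'a \<Rightarrow> real) \<Rightarrow> 'a \<Rightarrow> 'a \<Rightarrow> 'a"
where
  "riem_exp V M g p v = (THE q. \<exists>I c. maximal_geodesic V M g p v I c \<and> 1 \<in> I \<and> c 1 = q)"

text \<open>The inverse of the exponential map on its whole domain; it is meant for manifolds in which
  any two points are joined by a unique geodesic.\<close>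

definition riem_log ::
  "'a::euclidean_space set \<Rightarrow> 'a set \<Rightarrow> ('a \<Rightarrow> 'a \<Rightarrow> 'a \<Rightarrow> real) \<Rightarrow> 'a \<Rightarrow> 'a \<Rightarrow> 'a"
where
  "riem_log V M g p = the_inv_into (exp_domain V M g p) (riem_exp V M g p)"

definition parallel_transport_along ::
  "'a::euclidean_space set \<Rightarrow> 'a set \<Rightarrow> ('a \<Rightarrow> 'a \<Rightarrow> 'a \<Rightarrow> real) \<Rightarrow> (real \<Rightarrow> 'a) \<Rightarrow>
     real \<Rightarrow> real \<Rightarrow> 'a \<Rightarrow> 'a"
where
  "parallel_transport_along V M g c a b v =
     (THE z. \<exists>W. parallel_along V M g {a..b} c W \<and> W a = v \<and> W b = z)"

text \<open>Parallel transport from \<open>p\<close> to \<open>q\<close> along the connecting geodesic.\<close>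

definition parallel_transport ::
  "'a::euclidean_space set \<Rightarrow> 'a set \<Rightarrow> ('a \<Rightarrow> 'a \<Rightarrow> 'a \<Rightarrow> real) \<Rightarrow> 'a \<Rightarrow> 'a \<Rightarrow> 'a \<Rightarrow> 'a"
where
  "parallel_transport V M g p q =
     parallel_transport_along V M g (\<lambda>t. riem_exp V M g p (t *\<^sub>R riem_log V M g p q)) 0 1"

definition speed ::
  "('a::euclidean_space \<Rightarrow> 'a \<Rightarrow> 'a \<Rightarrow> real) \<Rightarrow> (real \<Rightarrow> 'a) \<Rightarrow> real \<Rightarrow> real"
where
  "speed g c t = sqrt (g (c t) (vector_derivative c (at t)) (vector_derivative c (at t)))"

text \<open>The constant \<open>valid_path\<close> (continuous and piecewise \<open>C\<^sup>1\<close> on \<open>{0..1}\<close>) allows the derivative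
  to be unbounded near the exceptional points, and the integral of a non-integrable function
  is \<open>0\<close> by convention. Integrability of the speed is therefore required; it holds for every
  curve that is \<open>C\<^sup>1\<close> on the closed pieces of a partition.\<close>

definition riem_dist ::
  "'a::euclidean_space set \<Rightarrow> ('a \<Rightarrow> 'a \<Rightarrow> 'a \<Rightarrow> real) \<Rightarrow> 'a \<Rightarrow> 'a \<Rightarrow> real"
where
  "riem_dist M g p q =
     Inf {integral {0..1} (speed g c) | c.
            valid_path c \<and> path_image c \<subseteq> M \<and> pathstart c = p \<and> pathfinish c = q \<and>
            speed g c integrable_on {0..1}}"

definition weighted_frechet_mean ::
  "'a::euclidean_space set \<Rightarrow> ('a \<Rightarrow> 'a \<Rightarrow> 'a \<Rightarrow> real) \<Rightarrow> nat \<Rightarrow> (nat \<Rightarrow> real) \<Rightarrow> (nat \<Rightarrow> 'a) \<Rightarrow> 'a"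
where
  "weighted_frechet_mean M g N w q =
     (THE p. is_arg_min (\<lambda>p. \<Sum>i=1..N. w i * (riem_dist M g p (q i))\<^sup>2) (\<lambda>p. p \<in> M) p)"


section \<open>The Cholesky manifold with the diagonal power metric\<close>

text \<open>
  An \<open>n \<times> n\<close> matrix is indexed by a finite linearly ordered type with \<open>n\<close> elements, and
  \<open>A $ i $ j\<close> is the entry in row \<open>i\<close> and column \<open>j\<close>. The library's inner product and norm on
  \<open>real ^ 'n ^ 'n\<close> are the Frobenius inner product and norm.
\<close>

type_synonym 'n sq_matrix = "((real, 'n) vec, 'n) vec"

definition lower_triangular :: "'n::{finite,linorder} sq_matrix set" where
  "lower_triangular = {A. \<forall>i j. i < j \<longrightarrow> A $ i $ j = 0}"

definition cholesky :: "'n::{finite,linorder} sq_matrix set" where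
  "cholesky = {A \<in> lower_triangular. \<forall>i. 0 < A $ i $ i}"

definition pos_diagonal :: "'n::finite sq_matrix set" where
  "pos_diagonal = {A. (\<forall>i j. i \<noteq> j \<longrightarrow> A $ i $ j = 0) \<and> (\<forall>i. 0 < A $ i $ i)}"

definition strict_lower :: "'n::{finite,linorder} sq_matrix \<Rightarrow> 'n sq_matrix" where
  "strict_lower A = (\<chi> i j. if j < i then A $ i $ j else 0)"

definition diag_part :: "'n::finite sq_matrix \<Rightarrow> 'n sq_matrix" where
  "diag_part A = (\<chi> i j. if i = j then A $ i $ j else 0)"

text \<open>Real power of a positive diagonal matrix, taken entrywise on the diagonal only.\<close>

definition diag_powr :: "'n::finite sq_matrix \<Rightarrow> real \<Rightarrow> 'n sq_matrix" where
  "diag_powr A a = (\<chi> i j. if i = j then (A $ i $ j) powr a else 0)"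

definition power_euclidean_metric :: "real \<Rightarrow> real \<Rightarrow> real \<Rightarrow> real \<Rightarrow> real" where
  "power_euclidean_metric \<theta> p v w =
     1 / \<theta>\<^sup>2 * frechet_derivative (\<lambda>x. x powr \<theta>) (at p) v
            * frechet_derivative (\<lambda>x. x powr \<theta>) (at p) w"

definition diagonal_power_metric ::
  "real \<Rightarrow> 'n::{finite,linorder} sq_matrix \<Rightarrow> 'n sq_matrix \<Rightarrow> 'n sq_matrix \<Rightarrow> real"
where
  "diagonal_power_metric \<theta> L X Y =
     strict_lower X \<bullet> strict_lower Y +
     (\<Sum>i\<in>UNIV. power_euclidean_metric \<theta> (L $ i $ i) (X $ i $ i) (Y $ i $ i))"

end

theory Submission
  imports Defs
begin

text \<open>
  The map \<open>A \<mapsto> \<lfloor>A\<rfloor> + diag(A\<^sub>i\<^sub>i powr \<theta>) / \<theta>\<close> is a global isometry from the Cholesky manifold onto a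
  convex subset of the Euclidean space of lower triangular matrices. Geodesics, logarithm, parallel
  transport, distance and Frechet mean are therefore the pullbacks of straight lines, differences,
  constant fields, the Frobenius distance and the arithmetic mean. A geodesic is maximal because
  the straight line leaves the image exactly where a diagonal entry of \<open>L + t \<theta> X\<close> vanishes.
\<close>

section \<open>Levi-Civita connections and geodesics in a global chart\<close>

text \<open>The connection is a \<open>SOME\<close>, and exponential map, transport and mean are
  \<open>THE\<close> values, so a formula never suffices by itself: each object needs existence
  together with uniqueness. Uniqueness theorems for differential equations are replaced by one
  computation: the differential of the chart carries the covariant derivative along a curve to the
  ordinary derivative. A parallel field therefore has a constant image in the chart, which
  determines transport, and, applied to the velocity, determines geodesics and bounds their
  intervals. A second obstacle is that \<open>levi_civita\<close> is pinned down only at points of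
  the manifold and on tangent vectors. The result below, a pointwise algebraic argument, gives
  exactly that much, so velocities have to be recognised as lower triangular before the explicit
  connection can replace the chosen one.\<close>

lemma levi_civita_unique:
  assumes \<Gamma>: "is_levi_civita V M g \<Gamma>" and \<Gamma>': "is_levi_civita V M g \<Gamma>'"
    and "p \<in> M" "v \<in> V" "w \<in> V" and V: "subspace V" and g: "bilinear (g p)"
    and sym: "\<And>x y. g p x y = g p y x" and definite: "\<And>x. x \<in> V \<Longrightarrow> g p x x = 0 \<Longrightarrow> x = 0"
  shows "\<Gamma> p v w = \<Gamma>' p v w"
proof -
  define A where "A x y = \<Gamma> p x y - \<Gamma>' p x y" for x y
  have A_V: "A x y \<in> V" and A_sym: "A x y = A y x" if "x \<in> V" "y \<in> V" for x y
    using \<Gamma> \<Gamma>' \<open>p \<in> M\<close> that V by (auto simp: A_def is_levi_civita_def intro: subspace_diff)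
  \<comment> \<open>Both connections express the derivative of one and the same function; equating
    the two expressions leaves the skewness of their difference.\<close>
  have A_skew: "g p (A z x) y = - g p (A z y) x" if "x \<in> V" "y \<in> V" "z \<in> V" for x y z
  proof -
    have "((\<lambda>t. g (p + t *\<^sub>R z) x y) has_real_derivative
              g p (\<Gamma> p z x) y + g p x (\<Gamma> p z y)) (at 0)"
      and "((\<lambda>t. g (p + t *\<^sub>R z) x y) has_real_derivative
              g p (\<Gamma>' p z x) y + g p x (\<Gamma>' p z y)) (at 0)"
      using \<Gamma> \<Gamma>' \<open>p \<in> M\<close> that unfolding is_levi_civita_def by blast+
    then have "g p (\<Gamma> p z x) y + g p x (\<Gamma> p z y) = g p (\<Gamma>' p z x) y + g p x (\<Gamma>' p z y)"
      by (rule DERIV_unique)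
    then show ?thesis
      using sym[of x] by (simp add: A_def bilinear_lsub[OF g])
  qed
  \<comment> \<open>\<open>g (A x y) z\<close> is symmetric in \<open>x, y\<close> and skew in \<open>y, z\<close>, hence zero.\<close>
  have "g p (A x y) z = 0" if "x \<in> V" "y \<in> V" "z \<in> V" for x y z
    using A_skew A_sym that by (smt (verit, best))
  then have "A v w = 0"
    using definite[OF A_V] A_V assms(4,5) by simp
  then show ?thesis
    by (simp add: A_def)
qed

text \<open>Each of the two is a restriction of the other. Hence \<open>riem_exp\<close> and
  \<open>exp_domain\<close> can be evaluated on any single maximal geodesic that is
  exhibited.\<close>

lemma maximal_geodesic_unique:
  assumes "maximal_geodesic V M g p v I c" "maximal_geodesic V M g p v I' c'"
  shows "I' = I" "\<And>t. t \<in> I \<Longrightarrow> c' t = c t"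
  using assms unfolding maximal_geodesic_def by blast+

lemma riem_exp_eq:
  assumes "maximal_geodesic V M g p v I c" "1 \<in> I"
  shows "riem_exp V M g p v = c 1"
  unfolding riem_exp_def
  using assms maximal_geodesic_unique[OF assms(1)] by (intro the_equality) blast+

lemma exp_domain_iff:
  assumes "maximal_geodesic V M g p v I c"
  shows "v \<in> exp_domain V M g p \<longleftrightarrow> v \<in> V \<and> 1 \<in> I"
  using assms maximal_geodesic_unique(1)[OF assms] unfolding exp_domain_def by blast

section \<open>Matrices with vanishing or positive entries\<close>

text \<open>Inner products with basis matrices are entries, so every derivative below reduces to
  real calculus on the diagonal and a trivial case off it.\<close>

lemma has_vector_derivative_matrix_iff:
  fixes f :: "real \<Rightarrow> ((real, 'n::finite) vec, 'm::finite) vec"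
  shows "(f has_vector_derivative f') (at x within S) \<longleftrightarrow>
    (\<forall>i j. ((\<lambda>t. f t $ i $ j) has_real_derivative f' $ i $ j) (at x within S))"
  unfolding has_vector_derivative_def has_derivative_componentwise_within[of f]
  by (auto simp: Basis_vec_def inner_axis has_field_derivative_def mult.commute[of _ "f' $ _ $ _"])

lemma inner_matrix:
  fixes A B :: "((real, 'n::finite) vec, 'm::finite) vec"
  shows "A \<bullet> B = (\<Sum>i\<in>UNIV. \<Sum>j\<in>UNIV. A $ i $ j * B $ i $ j)"
  by (simp add: inner_vec_def)

lemma diag_part_nth: "diag_part A $ i $ j = (if i = j then A $ i $ i else 0)"
  by (auto simp: diag_part_def)

lemma strict_lower_nth: "strict_lower A $ i $ j = (if j < i then A $ i $ j else 0)"
  by (simp add: strict_lower_def)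

lemma diag_powr_nth: "diag_powr A a $ i $ j = (if i = j then A $ i $ i powr a else 0)"
  by (auto simp: diag_powr_def)

lemma diag_part_mult_nth: "(diag_part A ** B) $ i $ j = A $ i $ i * B $ i $ j"
  by (simp add: matrix_matrix_mult_def diag_part_nth if_distrib[of "\<lambda>x. x * _"] cong: if_cong)

lemma diag_powr_mult_nth: "(diag_powr A a ** B) $ i $ j = A $ i $ i powr a * B $ i $ j"
  by (simp add: matrix_matrix_mult_def diag_powr_nth if_distrib[of "\<lambda>x. x * _"] cong: if_cong)

lemmas diag_nth = diag_part_nth strict_lower_nth diag_powr_nth diag_part_mult_nth diag_powr_mult_nth

text \<open>The supports are disjoint. This orthogonality is what splits the metric and the squared
  distance into two independent terms.\<close>

lemma strict_lower_inner_diag: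
  "strict_lower A \<bullet> diag_powr B a = 0"
  "strict_lower A \<bullet> (diag_powr B a ** diag_part C) = 0"
  by (auto simp: inner_matrix diag_nth intro!: sum.neutral)

lemma diag_powr_diag_part: "diag_powr (diag_part A) a = diag_powr A a"
  by (simp add: vec_eq_iff diag_nth)

text \<open>\<open>matrix_inv\<close> is a choice of which only the defining equations are known; a
  given left inverse identifies it.\<close>

lemma matrix_inv_unique:
  fixes A B :: "'n::finite sq_matrix"
  assumes "A ** B = mat 1" "B ** A = mat 1"
  shows "matrix_inv A = B"
proof -
  have "A ** matrix_inv A = mat 1"
    unfolding matrix_inv_def using assms by (rule_tac someI2[of _ B]) auto
  then have "(B ** A) ** matrix_inv A = B"
    by (simp flip: matrix_mul_assoc)
  then show ?thesis
    using assms by simp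
qed

lemma matrix_inv_diag_part:
  assumes "\<And>i. A $ i $ i \<noteq> 0"
  shows "matrix_inv (diag_part A) = diag_part (\<chi> i j. inverse (A $ i $ j))"
  using assms
  by (intro matrix_inv_unique) (auto simp: vec_eq_iff diag_nth mat_def)

section \<open>The tangent space of lower triangular matrices\<close>

lemma subspace_lower_triangular: "subspace lower_triangular"
  by (auto simp: subspace_def lower_triangular_def)

lemma choleskyD: "A \<in> cholesky \<Longrightarrow> 0 < A $ i $ i" "A \<in> cholesky \<Longrightarrow> A \<in> lower_triangular"
  by (auto simp: cholesky_def)

text \<open>An entry that vanishes along the whole curve has derivative zero, and derivatives are
  unique where the filter is nontrivial. It supplies the tangency of velocities, which
  \<open>parallel_along\<close> does not state.\<close>

lemma lower_triangular_vector_derivative: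
  assumes c: "(c has_vector_derivative c') (at x within I)" and "at x within I \<noteq> bot" "x \<in> I"
    and "\<And>t. t \<in> I \<Longrightarrow> c t \<in> lower_triangular"
  shows "c' \<in> lower_triangular"
  unfolding lower_triangular_def
proof (clarify)
  fix i j :: 'a assume "i < j"
  have "((\<lambda>t. c t $ i $ j) has_vector_derivative c' $ i $ j) (at x within I)"
    using c by (simp add: has_vector_derivative_matrix_iff has_real_derivative_iff_has_vector_derivative)
  moreover have "((\<lambda>t. c t $ i $ j) has_vector_derivative 0) (at x within I)"
    using assms \<open>i < j\<close>
    by (intro has_vector_derivative_transform[OF _ _ has_vector_derivative_const])
       (auto simp: lower_triangular_def)
  ultimately show "c' $ i $ j = 0"
    using assms(2) vector_derivative_unique_within by blast
qed

section \<open>The isometry onto a convex set of lower triangular matrices\<close>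

text \<open>The factor \<open>1 / \<theta>\<close> cancels the one produced by differentiating the
  power: a diagonal entry \<open>p\<close> gets the derivative \<open>p powr (\<theta> - 1)\<close>,
  whose square is the coefficient of the metric.\<close>

definition dpm_chart :: "real \<Rightarrow> 'n::{finite,linorder} sq_matrix \<Rightarrow> 'n sq_matrix" where
  "dpm_chart \<theta> A = strict_lower A + (1 / \<theta>) *\<^sub>R diag_powr A \<theta>"

definition dpm_chart_inv :: "real \<Rightarrow> 'n::{finite,linorder} sq_matrix \<Rightarrow> 'n sq_matrix" where
  "dpm_chart_inv \<theta> B = strict_lower B + diag_powr (\<theta> *\<^sub>R B) (1 / \<theta>)"

text \<open>For negative \<open>\<theta>\<close> the chart has a negative diagonal. Multiplying by
  \<open>\<theta>\<close> covers both signs by one condition that is linear in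
  \<open>B\<close>.\<close>

definition dpm_image :: "real \<Rightarrow> 'n::{finite,linorder} sq_matrix set" where
  "dpm_image \<theta> = {B \<in> lower_triangular. \<forall>i. 0 < \<theta> * B $ i $ i}"

text \<open>The differential of the chart at \<open>A\<close>; its inverse is \<open>dpm_dchart (2 - \<theta>) A\<close>.\<close>

definition dpm_dchart :: "real \<Rightarrow> 'n::{finite,linorder} sq_matrix \<Rightarrow> 'n sq_matrix \<Rightarrow> 'n sq_matrix"
  where "dpm_dchart \<theta> A X = strict_lower X + diag_powr A (\<theta> - 1) ** diag_part X"

text \<open>On each diagonal entry this is the one-dimensional Christoffel symbol, half the
  logarithmic derivative of the coefficient \<open>p powr (2 * \<theta> - 2)\<close>; the strictly
  lower part is flat and contributes zero.\<close>

definition dpm_christoffel ::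
  "real \<Rightarrow> 'n::{finite,linorder} sq_matrix \<Rightarrow> 'n sq_matrix \<Rightarrow> 'n sq_matrix \<Rightarrow> 'n sq_matrix" where
  "dpm_christoffel \<theta> A X Y =
     (\<chi> i j. if i = j then (\<theta> - 1) / A $ i $ i * X $ i $ i * Y $ i $ i else 0)"

lemma dpm_chart_nth:
  "dpm_chart \<theta> A $ i $ j = (if i = j then A $ i $ i powr \<theta> / \<theta> else if j < i then A $ i $ j else 0)"
  by (auto simp: dpm_chart_def diag_nth)

lemma dpm_chart_inv_nth:
  "dpm_chart_inv \<theta> B $ i $ j =
    (if i = j then (\<theta> * B $ i $ i) powr (1 / \<theta>) else if j < i then B $ i $ j else 0)"
  by (auto simp: dpm_chart_inv_def diag_nth)

lemma dpm_dchart_nth: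
  "dpm_dchart \<theta> A X $ i $ j =
    (if i = j then A $ i $ i powr (\<theta> - 1) * X $ i $ i else if j < i then X $ i $ j else 0)"
  by (auto simp: dpm_dchart_def diag_nth)

lemma dpm_christoffel_nth:
  "dpm_christoffel \<theta> A X Y $ i $ j =
    (if i = j then (\<theta> - 1) / A $ i $ i * X $ i $ i * Y $ i $ i else 0)"
  by (auto simp: dpm_christoffel_def)

lemmas dpm_nth = dpm_chart_nth dpm_chart_inv_nth dpm_dchart_nth dpm_christoffel_nth

lemma dpm_chart_in_image:
  assumes "\<theta> \<noteq> 0" "A \<in> cholesky"
  shows "dpm_chart \<theta> A \<in> dpm_image \<theta>"
  using assms(1) choleskyD(1)[OF assms(2)]
  by (auto simp: dpm_image_def lower_triangular_def dpm_nth less_imp_neq[symmetric])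

lemma dpm_chart_inv_in_cholesky:
  assumes "B \<in> dpm_image \<theta>"
  shows "dpm_chart_inv \<theta> B \<in> cholesky"
proof -
  have "0 < (\<theta> * B $ i $ i) powr (1 / \<theta>)" for i
    using assms unfolding dpm_image_def powr_gt_zero
    by (metis (mono_tags, lifting) less_irrefl mem_Collect_eq)
  then show ?thesis
    by (auto simp: cholesky_def lower_triangular_def dpm_chart_inv_nth)
qed

lemma dpm_chart_inv_chart:
  assumes "\<theta> \<noteq> 0" "A \<in> cholesky"
  shows "dpm_chart_inv \<theta> (dpm_chart \<theta> A) = A"
  using choleskyD[OF assms(2)] assms(1)
  by (auto simp: vec_eq_iff lower_triangular_def dpm_nth powr_powr order_less_imp_le
        not_less_iff_gr_or_eq)

lemma dpm_chart_chart_inv: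
  assumes "\<theta> \<noteq> 0" "B \<in> dpm_image \<theta>"
  shows "dpm_chart \<theta> (dpm_chart_inv \<theta> B) = B"
proof -
  have "0 < \<theta> * B $ i $ i" "i < j \<Longrightarrow> B $ i $ j = 0" for i j
    using assms(2) by (auto simp: dpm_image_def lower_triangular_def)
  then show ?thesis
    using assms(1)
    by (auto simp: vec_eq_iff dpm_nth powr_powr order_less_imp_le not_less_iff_gr_or_eq)
qed

text \<open>The exponents \<open>\<theta> - 1\<close> and \<open>(2 - \<theta>) - 1\<close> are
  opposite. Having the inverse in the same family lets the derivative rule for
  \<open>dpm_dchart\<close> serve for both.\<close>

lemma dpm_dchart_inverse:
  assumes "A \<in> cholesky" "X \<in> lower_triangular"
  shows "dpm_dchart (2 - \<theta>) A (dpm_dchart \<theta> A X) = X"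
    and "dpm_dchart \<theta> A (dpm_dchart (2 - \<theta>) A X) = X"
  using assms
  by (auto simp: vec_eq_iff dpm_nth lower_triangular_def not_less_iff_gr_or_eq cholesky_def
      less_imp_neq[symmetric] simp flip: powr_add mult.assoc)

lemma dpm_dchart_lower_triangular: "dpm_dchart \<theta> A X \<in> lower_triangular"
  by (auto simp: lower_triangular_def dpm_nth)

lemma dpm_dchart_linear:
  "dpm_dchart \<theta> A (X + Y) = dpm_dchart \<theta> A X + dpm_dchart \<theta> A Y"
  "dpm_dchart \<theta> A (r *\<^sub>R X) = r *\<^sub>R dpm_dchart \<theta> A X"
  by (auto simp: vec_eq_iff dpm_nth algebra_simps)

lemma dpm_dchart_eq_0_iff:
  assumes "A \<in> cholesky" "X \<in> lower_triangular"
  shows "dpm_dchart \<theta> A X = 0 \<longleftrightarrow> X = 0"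
  using dpm_dchart_inverse(1)[OF assms, of \<theta>] dpm_dchart_linear(2)[of _ A 0] by (metis scaleR_zero_left)

section \<open>The metric as the pullback of the Frobenius inner product\<close>

lemma power_euclidean_metric_eq:
  assumes "\<theta> \<noteq> 0" "0 < p"
  shows "power_euclidean_metric \<theta> p v w = (p powr (\<theta> - 1) * v) * (p powr (\<theta> - 1) * w)"
proof -
  have "((\<lambda>x. x powr \<theta>) has_derivative (*) (\<theta> * p powr (\<theta> - 1))) (at p)"
    using has_real_derivative_powr[OF assms(2), of \<theta>] by (simp add: has_field_derivative_def)
  from frechet_derivative_at[OF this, symmetric] show ?thesis
    using assms(1) by (simp add: power_euclidean_metric_def power2_eq_square)
qed

text \<open>Stated for a positive diagonal, because metric compatibility uses it along
  \<open>p + t *\<^sub>R z\<close>, where positivity near \<open>t = 0\<close> is what is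
  established.\<close>

lemma dpm_eq_inner:
  assumes "\<theta> \<noteq> 0" "\<And>i. 0 < A $ i $ i"
  shows "diagonal_power_metric \<theta> A X Y = dpm_dchart \<theta> A X \<bullet> dpm_dchart \<theta> A Y"
proof -
  have "dpm_dchart \<theta> A X \<bullet> dpm_dchart \<theta> A Y =
     (\<Sum>i\<in>UNIV. \<Sum>j\<in>UNIV. strict_lower X $ i $ j * strict_lower Y $ i $ j +
        (if i = j then power_euclidean_metric \<theta> (A $ i $ i) (X $ i $ i) (Y $ i $ i) else 0))"
    unfolding inner_matrix using assms
    by (intro sum.cong refl) (auto simp: dpm_nth strict_lower_nth power_euclidean_metric_eq)
  then show ?thesis
    by (simp add: diagonal_power_metric_def inner_matrix sum.distrib)
qed

lemma dpm_chart_has_vector_derivative: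
  assumes "\<theta> \<noteq> 0" and "c x \<in> cholesky" and "(c has_vector_derivative c') (at x within S)"
  shows "((\<lambda>t. dpm_chart \<theta> (c t)) has_vector_derivative dpm_dchart \<theta> (c x) c') (at x within S)"
  unfolding has_vector_derivative_matrix_iff
proof (intro allI)
  fix i j
  note [derivative_intros] = assms(3)[unfolded has_vector_derivative_matrix_iff, rule_format]
  show "((\<lambda>t. dpm_chart \<theta> (c t) $ i $ j) has_real_derivative dpm_dchart \<theta> (c x) c' $ i $ j)
      (at x within S)"
    using assms(1) choleskyD(1)[OF assms(2)]
    by (cases "i = j"; cases "j < i") (auto simp: dpm_nth intro!: derivative_eq_intros)
qed

lemma dpm_chart_inv_has_vector_derivative:
  assumes "\<theta> \<noteq> 0" and "b x \<in> dpm_image \<theta>" and "(b has_vector_derivative b') (at x within S)"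
  shows "((\<lambda>t. dpm_chart_inv \<theta> (b t)) has_vector_derivative
            dpm_dchart (2 - \<theta>) (dpm_chart_inv \<theta> (b x)) b') (at x within S)"
  unfolding has_vector_derivative_matrix_iff
proof (intro allI)
  fix i j
  have pos: "\<And>i. 0 < \<theta> * b x $ i $ i"
    using assms(2) by (auto simp: dpm_image_def)
  \<comment> \<open>With \<open>p = (\<theta> * b) powr (1 / \<theta>)\<close>, this identifies
    \<open>p powr (1 - \<theta>)\<close> with the power
    \<open>(\<theta> * b) powr (1 / \<theta> - 1)\<close> left by the chain rule.\<close>
  have *: "(1 - \<theta>) / \<theta> = 1 / \<theta> - 1"
    using assms(1) by (simp add: field_simps)
  note [derivative_intros] = assms(3)[unfolded has_vector_derivative_matrix_iff, rule_format]
  show "((\<lambda>t. dpm_chart_inv \<theta> (b t) $ i $ j) has_real_derivative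
      dpm_dchart (2 - \<theta>) (dpm_chart_inv \<theta> (b x)) b' $ i $ j) (at x within S)"
    using assms(1) pos
    by (cases "i = j"; cases "j < i") (auto simp: dpm_nth powr_powr * intro!: derivative_eq_intros)
qed

text \<open>In the chart, covariant differentiation is ordinary differentiation.\<close>

lemma dpm_dchart_has_vector_derivative:
  assumes "c x \<in> cholesky" and "(c has_vector_derivative c') (at x within S)"
    and "(W has_vector_derivative W') (at x within S)"
  shows "((\<lambda>t. dpm_dchart \<theta> (c t) (W t)) has_vector_derivative
            dpm_dchart \<theta> (c x) (W' + dpm_christoffel \<theta> (c x) c' (W x))) (at x within S)"
  unfolding has_vector_derivative_matrix_iff
proof (intro allI)
  fix i j
  note [derivative_intros] = assms(2,3)[unfolded has_vector_derivative_matrix_iff, rule_format]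
  have pos: "\<And>i. 0 < c x $ i $ i"
    using choleskyD(1)[OF assms(1)] .
  \<comment> \<open>Differentiating the coefficient \<open>p powr (\<theta> - 1)\<close> lowers its
    exponent once more; writing that as a division by \<open>p\<close> exhibits the Christoffel
    term.\<close>
  then have *: "c x $ i $ i powr (\<theta> - 2) = c x $ i $ i powr (\<theta> - 1) / c x $ i $ i" for i
    using powr_diff[of "c x $ i $ i" "\<theta> - 1" 1] by (simp add: order_less_imp_le)
  show "((\<lambda>t. dpm_dchart \<theta> (c t) (W t) $ i $ j) has_real_derivative
      dpm_dchart \<theta> (c x) (W' + dpm_christoffel \<theta> (c x) c' (W x)) $ i $ j) (at x within S)"
    using pos
    by (cases "i = j"; cases "j < i")
       (auto simp: dpm_nth * algebra_simps intro!: derivative_eq_intros)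
qed

lemma dpm_is_levi_civita:
  assumes "\<theta> \<noteq> 0"
  shows "is_levi_civita lower_triangular cholesky (diagonal_power_metric \<theta>)
    (dpm_christoffel \<theta> :: 'n::{finite,linorder} sq_matrix \<Rightarrow> _)"
  unfolding is_levi_civita_def
proof (intro ballI conjI)
  fix p z v w :: "'n sq_matrix" assume p: "p \<in> cholesky"
  show "bilinear (dpm_christoffel \<theta> p)"
    unfolding bilinear_def by (auto intro!: linearI simp: vec_eq_iff dpm_nth algebra_simps add_divide_distrib diff_divide_distrib)
  show "dpm_christoffel \<theta> p v w \<in> lower_triangular"
    by (auto simp: lower_triangular_def dpm_nth)
  show "dpm_christoffel \<theta> p v w = dpm_christoffel \<theta> p w v"
    by (auto simp: vec_eq_iff dpm_nth)
  let ?c = "\<lambda>t::real. p + t *\<^sub>R z"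
  have c: "(?c has_vector_derivative z) (at 0)"
    by (auto intro!: derivative_eq_intros)
  \<comment> \<open>For a constant field only the Christoffel term survives, so compatibility
    becomes the product rule for the inner product.\<close>
  have D: "((\<lambda>t. dpm_dchart \<theta> (?c t) u) has_vector_derivative
      dpm_dchart \<theta> p (dpm_christoffel \<theta> p z u)) (at 0)" for u
    using dpm_dchart_has_vector_derivative[of ?c 0, OF _ c has_vector_derivative_const[of u]] p
    by simp
  have "((\<lambda>t. dpm_dchart \<theta> (?c t) v \<bullet> dpm_dchart \<theta> (?c t) w) has_real_derivative
          dpm_dchart \<theta> p (dpm_christoffel \<theta> p z v) \<bullet> dpm_dchart \<theta> p w +
          dpm_dchart \<theta> p v \<bullet> dpm_dchart \<theta> p (dpm_christoffel \<theta> p z w)) (at 0)"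
    unfolding has_real_derivative_iff_has_vector_derivative
    using bounded_bilinear.has_vector_derivative[OF bounded_bilinear_inner D[of v] D[of w]]
    by (simp add: add.commute)
  \<comment> \<open>The inner product formula holds only while the diagonal is positive. That is
    true near \<open>0\<close>, which is enough for the derivative there.\<close>
  moreover have "\<forall>\<^sub>F t in nhds 0. diagonal_power_metric \<theta> (?c t) v w =
      dpm_dchart \<theta> (?c t) v \<bullet> dpm_dchart \<theta> (?c t) w"
  proof -
    have "\<forall>\<^sub>F t in nhds 0. 0 < ?c t $ i $ i" for i
    proof (rule order_tendstoD)
      have "((\<lambda>t. p $ i $ i + t * z $ i $ i) \<longlongrightarrow> p $ i $ i + 0 * z $ i $ i) (nhds 0)"
        by (intro tendsto_intros filterlim_ident)
      then show "((\<lambda>t. ?c t $ i $ i) \<longlongrightarrow> p $ i $ i) (nhds 0)"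
        by simp
    qed (use p in \<open>simp add: cholesky_def\<close>)
    then have "\<forall>\<^sub>F t in nhds 0. \<forall>i. 0 < ?c t $ i $ i"
      by (rule eventually_all_finite)
    then show ?thesis
      by eventually_elim (simp add: dpm_eq_inner assms)
  qed
  ultimately show "((\<lambda>t. diagonal_power_metric \<theta> (?c t) v w) has_real_derivative
      diagonal_power_metric \<theta> p (dpm_christoffel \<theta> p z v) w +
      diagonal_power_metric \<theta> p v (dpm_christoffel \<theta> p z w)) (at 0)"
    using p assms by (subst DERIV_cong_ev[OF refl _ refl]) (auto simp: dpm_eq_inner cholesky_def)
qed

text \<open>Since some Levi-Civita connection exists, the chosen one is such a connection too, and
  uniqueness evaluates it on tangent vectors.\<close>

lemma dpm_levi_civita:
  assumes "\<theta> \<noteq> 0" "p \<in> cholesky" "v \<in> lower_triangular" "w \<in> lower_triangular"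
  shows "levi_civita lower_triangular cholesky (diagonal_power_metric \<theta>) p v w =
    dpm_christoffel \<theta> p v w"
proof (rule levi_civita_unique[where V = lower_triangular and M = cholesky and
      g = "diagonal_power_metric \<theta>" and \<Gamma> = "levi_civita _ _ _" and \<Gamma>' = "dpm_christoffel \<theta>"])
  show "is_levi_civita lower_triangular cholesky (diagonal_power_metric \<theta>)
      (levi_civita lower_triangular cholesky (diagonal_power_metric \<theta>))"
    unfolding levi_civita_def
    by (rule someI[of "is_levi_civita _ _ _", OF dpm_is_levi_civita[OF assms(1)]])
  have g: "diagonal_power_metric \<theta> p X Y = dpm_dchart \<theta> p X \<bullet> dpm_dchart \<theta> p Y" for X Y
    using assms by (simp add: dpm_eq_inner cholesky_def)
  show "bilinear (diagonal_power_metric \<theta> p)"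
    unfolding bilinear_def g by (auto intro!: linearI simp: dpm_dchart_linear inner_add)
  show "diagonal_power_metric \<theta> p X Y = diagonal_power_metric \<theta> p Y X" for X Y
    by (simp add: g inner_commute)
  show "X = 0" if "X \<in> lower_triangular" "diagonal_power_metric \<theta> p X X = 0" for X
    using that assms by (simp add: g dpm_dchart_eq_0_iff)
qed (use assms dpm_is_levi_civita subspace_lower_triangular in auto)


section \<open>Straight lines in the image of the chart\<close>

lemma dpm_image_convex: "convex (dpm_image \<theta>)"
proof (rule convexI)
  fix A B :: "'a sq_matrix" and u v :: real
  assume A: "A \<in> dpm_image \<theta>" and B: "B \<in> dpm_image \<theta>"
    and uv: "0 \<le> u" "0 \<le> v" "u + v = 1"
  have "0 < \<theta> * (u *\<^sub>R A + v *\<^sub>R B) $ i $ i" for i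
  proof -
    have "0 < u * (\<theta> * A $ i $ i) + v * (\<theta> * B $ i $ i)"
      using A B uv convexD[of "{0<..}" "\<theta> * A $ i $ i" "\<theta> * B $ i $ i" u v]
      by (simp add: dpm_image_def)
    then show ?thesis
      by (simp add: algebra_simps)
  qed
  then show "u *\<^sub>R A + v *\<^sub>R B \<in> dpm_image \<theta>"
    using A B by (auto simp: dpm_image_def subspace_lower_triangular subspace_add subspace_scale)
qed

lemma convex_line_preimage:
  fixes S :: "'a::real_vector set"
  assumes "convex S"
  shows "convex {t::real. a + t *\<^sub>R b \<in> S}"
proof (rule convexI, clarify)
  fix x y u v :: real
  assume "a + x *\<^sub>R b \<in> S" "a + y *\<^sub>R b \<in> S" and uv: "0 \<le> u" "0 \<le> v" "u + v = 1"
  then have "u *\<^sub>R (a + x *\<^sub>R b) + v *\<^sub>R (a + y *\<^sub>R b) \<in> S"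
    using assms by (auto dest: convexD)
  also have "u *\<^sub>R (a + x *\<^sub>R b) + v *\<^sub>R (a + y *\<^sub>R b) = (u + v) *\<^sub>R a + (u *\<^sub>R x + v *\<^sub>R y) *\<^sub>R b"
    by (simp add: algebra_simps)
  finally show "a + (u *\<^sub>R x + v *\<^sub>R y) *\<^sub>R b \<in> S"
    by (simp add: uv)
qed

lemma open_line_preimage_dpm_image:
  assumes "A \<in> lower_triangular" "B \<in> lower_triangular"
  shows "open {t. A + t *\<^sub>R B \<in> dpm_image \<theta>}"
proof -
  have "{t. A + t *\<^sub>R B \<in> dpm_image \<theta>} = (\<Inter>i. {t. 0 < \<theta> * (A $ i $ i + t * B $ i $ i)})"
    using assms by (auto simp: dpm_image_def subspace_lower_triangular subspace_add subspace_scale)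
  moreover have "open {t. 0 < \<theta> * (A $ i $ i + t * B $ i $ i)}" for i
    by (intro open_Collect_less continuous_intros)
  ultimately show ?thesis
    by (simp add: open_INT)
qed

section \<open>Parallel fields and geodesics\<close>

text \<open>The image of \<open>W\<close> in the chart has as derivative the image of its covariant
  derivative, which is zero. Nontriviality of the filters excludes one-point intervals, where
  derivatives carry no information.\<close>

lemma dpm_parallel_along_constant:
  assumes "\<theta> \<noteq> 0" and W: "parallel_along lower_triangular cholesky (diagonal_power_metric \<theta>) I c W"
    and "convex I" and "\<And>t. t \<in> I \<Longrightarrow> at t within I \<noteq> bot" and "s \<in> I" "t \<in> I"
  shows "dpm_dchart \<theta> (c s) (W s) = dpm_dchart \<theta> (c t) (W t)"
proof -
  have *: "((\<lambda>t. dpm_dchart \<theta> (c t) (W t)) has_derivative (\<lambda>h. 0)) (at r within I)" if "r \<in> I" for r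
  proof -
    obtain c' W' where c: "(c has_vector_derivative c') (at r within I)"
      and W': "(W has_vector_derivative W') (at r within I)"
      and 0: "W' + levi_civita lower_triangular cholesky (diagonal_power_metric \<theta>) (c r) c' (W r) = 0"
      and M: "c r \<in> cholesky" "W r \<in> lower_triangular"
      using W \<open>r \<in> I\<close> unfolding parallel_along_def by blast
    have "c' \<in> lower_triangular"
      using lower_triangular_vector_derivative[OF c] assms(4) W \<open>r \<in> I\<close>
      by (auto simp: parallel_along_def choleskyD)
    then have "W' + dpm_christoffel \<theta> (c r) c' (W r) = 0"
      using 0 M assms(1) by (simp add: dpm_levi_civita)
    then show ?thesis
      using dpm_dchart_has_vector_derivative[OF M(1) c W', of \<theta>] dpm_dchart_linear(2)[of \<theta> "c r" 0 0]
      by (simp add: has_vector_derivative_def)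
  qed
  then obtain k where "\<And>r. r \<in> I \<Longrightarrow> dpm_dchart \<theta> (c r) (W r) = k"
    using has_derivative_zero_constant[OF \<open>convex I\<close> *] by blast
  then show ?thesis
    using \<open>s \<in> I\<close> \<open>t \<in> I\<close> by simp
qed

text \<open>The field is the pullback of the constant field \<open>U\<close>.\<close>

lemma dpm_parallel_along_exists:
  assumes "\<theta> \<noteq> 0" and "\<And>t. t \<in> I \<Longrightarrow> c t \<in> cholesky"
    and "\<And>t. t \<in> I \<Longrightarrow> (c has_vector_derivative c' t) (at t within I)"
    and "\<And>t. t \<in> I \<Longrightarrow> at t within I \<noteq> bot" and "U \<in> lower_triangular"
  shows "parallel_along lower_triangular cholesky (diagonal_power_metric \<theta>) I c
    (\<lambda>t. dpm_dchart (2 - \<theta>) (c t) U)"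
  unfolding parallel_along_def
proof (intro ballI conjI exI)
  fix t assume t: "t \<in> I"
  let ?W = "\<lambda>t. dpm_dchart (2 - \<theta>) (c t) U"
  let ?W' = "dpm_dchart (2 - \<theta>) (c t) (dpm_christoffel (2 - \<theta>) (c t) (c' t) U)"
  show M: "c t \<in> cholesky" and W: "?W t \<in> lower_triangular"
    using assms t by (auto simp: dpm_dchart_lower_triangular)
  show c: "(c has_vector_derivative c' t) (at t within I)"
    using assms t by auto
  show W': "(?W has_vector_derivative ?W') (at t within I)"
    using dpm_dchart_has_vector_derivative[OF M c has_vector_derivative_const[of U]] by simp
  have c': "c' t \<in> lower_triangular"
    using lower_triangular_vector_derivative[OF c] assms t by (auto simp: choleskyD)
  \<comment> \<open>The image of \<open>?W\<close> is differentiated in two ways: by the covariant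
    rule, and as the constant \<open>U\<close>. Injectivity of \<open>dpm_dchart\<close> then
    annihilates the covariant derivative, with no explicit cancellation of Christoffel
    terms.\<close>
  have "((\<lambda>t. dpm_dchart \<theta> (c t) (?W t)) has_vector_derivative
      dpm_dchart \<theta> (c t) (?W' + dpm_christoffel \<theta> (c t) (c' t) (?W t))) (at t within I)"
    by (rule dpm_dchart_has_vector_derivative[OF M c W'])
  moreover have "((\<lambda>t. dpm_dchart \<theta> (c t) (?W t)) has_vector_derivative 0) (at t within I)"
    using assms t
    by (intro has_vector_derivative_transform[OF _ _ has_vector_derivative_const[of U]])
       (auto simp: dpm_dchart_inverse)
  ultimately have "dpm_dchart \<theta> (c t) (?W' + dpm_christoffel \<theta> (c t) (c' t) (?W t)) = 0"
    using assms(4) t vector_derivative_unique_within by blast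
  moreover have "?W' + dpm_christoffel \<theta> (c t) (c' t) (?W t) \<in> lower_triangular"
    by (auto simp: lower_triangular_def dpm_nth)
  ultimately show "?W' + levi_civita lower_triangular cholesky (diagonal_power_metric \<theta>) (c t) (c' t) (?W t) = 0"
    using M c' W assms(1) by (simp add: dpm_levi_civita dpm_dchart_eq_0_iff)
qed

text \<open>The velocity is parallel, so its image is constant, and the curve in the chart differs
  from the line by a function with zero derivative.\<close>

lemma dpm_geodesic_chart:
  assumes "\<theta> \<noteq> 0"
    and c: "geodesic_from lower_triangular cholesky (diagonal_power_metric \<theta>) L X I c" and "t \<in> I"
  shows "dpm_chart \<theta> (c t) = dpm_chart \<theta> L + t *\<^sub>R dpm_dchart \<theta> L X"
proof -
  have I: "open I" "convex I" "0 \<in> I" and "c 0 = L" and X: "(c has_vector_derivative X) (at 0)"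
    using c by (auto simp: geodesic_from_def is_interval_convex_1)
  obtain c' where c': "\<And>t. t \<in> I \<Longrightarrow> (c has_vector_derivative c' t) (at t within I)"
    and par: "parallel_along lower_triangular cholesky (diagonal_power_metric \<theta>) I c c'"
    using c by (auto simp: geodesic_from_def geodesic_on_def)
  have nt: "at t within I \<noteq> bot" if "t \<in> I" for t
    by (simp add: at_within_open[OF that I(1)])
  \<comment> \<open>The velocity field comes from an existential, so its value at \<open>0\<close>
    still has to be matched with the prescribed \<open>X\<close>.\<close>
  have "(c has_vector_derivative c' 0) (at 0)"
    using c'[OF I(3)] by (simp only: at_within_open[OF I(3,1)])
  then have "c' 0 = X"
    using X by (rule vector_derivative_unique_at)
  then have const: "dpm_dchart \<theta> (c t) (c' t) = dpm_dchart \<theta> L X" if "t \<in> I" for t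
    using dpm_parallel_along_constant[OF assms(1) par I(2) nt that I(3)] \<open>c 0 = L\<close> by simp
  have *: "((\<lambda>t. dpm_chart \<theta> (c t) - t *\<^sub>R dpm_dchart \<theta> L X) has_derivative (\<lambda>h. 0)) (at r within I)"
    if "r \<in> I" for r
  proof -
    have "c r \<in> cholesky"
      using par that by (auto simp: parallel_along_def)
    from dpm_chart_has_vector_derivative[OF assms(1) this c'[OF that]]
    have "((\<lambda>t. dpm_chart \<theta> (c t) - t *\<^sub>R dpm_dchart \<theta> L X) has_vector_derivative
        dpm_dchart \<theta> L X - dpm_dchart \<theta> L X) (at r within I)"
      by (auto intro!: derivative_eq_intros simp: const[OF that])
    then show ?thesis
      by (simp add: has_vector_derivative_def)
  qed
  then obtain k where "\<And>r. r \<in> I \<Longrightarrow> dpm_chart \<theta> (c r) - r *\<^sub>R dpm_dchart \<theta> L X = k"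
    using has_derivative_zero_constant[OF I(2) *] by blast
  from this[OF \<open>t \<in> I\<close>] this[OF I(3)] show ?thesis
    by (simp add: \<open>c 0 = L\<close> algebra_simps)
qed

text \<open>The curve is prescribed on \<open>I\<close> only, so a closed formula may take arbitrary
  values elsewhere, for instance where a power has a nonpositive base.\<close>

lemma dpm_maximal_geodesic:
  assumes "\<theta> \<noteq> 0" "L \<in> cholesky" "X \<in> lower_triangular"
    and I: "I = {t. dpm_chart \<theta> L + t *\<^sub>R dpm_dchart \<theta> L X \<in> dpm_image \<theta>}"
    and c: "\<And>t. t \<in> I \<Longrightarrow> c t = dpm_chart_inv \<theta> (dpm_chart \<theta> L + t *\<^sub>R dpm_dchart \<theta> L X)"
  shows "maximal_geodesic lower_triangular cholesky (diagonal_power_metric \<theta>) L X I c"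
  unfolding maximal_geodesic_def
proof (intro conjI allI impI)
  let ?b = "\<lambda>t. dpm_chart \<theta> L + t *\<^sub>R dpm_dchart \<theta> L X"
  let ?c' = "\<lambda>t. dpm_dchart (2 - \<theta>) (c t) (dpm_dchart \<theta> L X)"
  have "open I"
    unfolding I using dpm_chart_in_image[OF assms(1,2)]
    by (intro open_line_preimage_dpm_image dpm_dchart_lower_triangular) (simp add: dpm_image_def)
  have "0 \<in> I"
    using assms by (simp add: dpm_chart_in_image)
  have M: "c t \<in> cholesky" if "t \<in> I" for t
    using that c I by (auto intro: dpm_chart_inv_in_cholesky)
  have nt: "at t within I \<noteq> bot" if "t \<in> I" for t
    by (simp add: at_within_open[OF that \<open>open I\<close>])
  have c': "(c has_vector_derivative ?c' t) (at t)" if "t \<in> I" for t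
  proof (rule has_vector_derivative_transform_within_open[OF _ \<open>open I\<close> that])
    have "(?b has_vector_derivative dpm_dchart \<theta> L X) (at t)"
      by (auto intro!: derivative_eq_intros)
    then show "((\<lambda>t. dpm_chart_inv \<theta> (?b t)) has_vector_derivative ?c' t) (at t)"
      unfolding c[OF that] using that I assms(1)
      by (intro dpm_chart_inv_has_vector_derivative) auto
  qed (simp add: c)
  show "geodesic_from lower_triangular cholesky (diagonal_power_metric \<theta>) L X I c"
    unfolding geodesic_from_def geodesic_on_def
  proof (intro conjI exI[of _ ?c'] ballI)
    show "is_interval I"
      unfolding I is_interval_convex_1 by (intro convex_line_preimage dpm_image_convex)
    show "c 0 = L"
      using c[OF \<open>0 \<in> I\<close>] assms by (simp add: dpm_chart_inv_chart)
    then show "(c has_vector_derivative X) (at 0)"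
      using c'[OF \<open>0 \<in> I\<close>] assms by (simp add: dpm_dchart_inverse)
    show *: "(c has_vector_derivative ?c' t) (at t within I)" if "t \<in> I" for t
      using c'[OF that] by (rule has_vector_derivative_at_within)
    show "parallel_along lower_triangular cholesky (diagonal_power_metric \<theta>) I c ?c'"
      by (rule dpm_parallel_along_exists[where c' = ?c', OF assms(1) M * nt dpm_dchart_lower_triangular])
  qed fact+
  fix I' d assume d: "geodesic_from lower_triangular cholesky (diagonal_power_metric \<theta>) L X I' d"
  have M': "d t \<in> cholesky" if "t \<in> I'" for t
    using d that by (auto simp: geodesic_from_def geodesic_on_def parallel_along_def)
  have d_chart: "dpm_chart \<theta> (d t) = ?b t" if "t \<in> I'" for t
    using dpm_geodesic_chart[OF assms(1) d that] .
  \<comment> \<open>A competitor stays on the manifold, so its chart values, which run along the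
    same line, stay in the image.\<close>
  show "I' \<subseteq> I"
    unfolding I using dpm_chart_in_image[OF assms(1) M'] by (auto simp: d_chart)
  then show "\<forall>t\<in>I'. d t = c t"
    using dpm_chart_inv_chart[OF assms(1) M'] d_chart c by auto
qed

section \<open>Exponential map and logarithm\<close>

lemma dpm_geodesic_exp:
  assumes "\<theta> \<noteq> 0" "L \<in> cholesky" "X \<in> lower_triangular"
  shows "X \<in> exp_domain lower_triangular cholesky (diagonal_power_metric \<theta>) L \<longleftrightarrow>
      dpm_chart \<theta> L + dpm_dchart \<theta> L X \<in> dpm_image \<theta>"
    and "dpm_chart \<theta> L + dpm_dchart \<theta> L X \<in> dpm_image \<theta> \<Longrightarrow>
      riem_exp lower_triangular cholesky (diagonal_power_metric \<theta>) L X =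
      dpm_chart_inv \<theta> (dpm_chart \<theta> L + dpm_dchart \<theta> L X)"
  using exp_domain_iff[OF dpm_maximal_geodesic[OF assms refl refl]]
    riem_exp_eq[OF dpm_maximal_geodesic[OF assms refl refl]] assms(3)
  by auto

text \<open>Seen through the chart, the exponential map is an injective linear map followed by a
  translation. It is thus injective on its whole domain, as the inverse in \<open>riem_log\<close>
  demands.\<close>

lemma dpm_riem_log:
  assumes "\<theta> \<noteq> 0" "L \<in> cholesky" "K \<in> cholesky"
  shows "riem_log lower_triangular cholesky (diagonal_power_metric \<theta>) L K =
    dpm_dchart (2 - \<theta>) L (dpm_chart \<theta> K - dpm_chart \<theta> L)"
  unfolding riem_log_def
proof (rule the_inv_into_f_eq)
  let ?D = "exp_domain lower_triangular cholesky (diagonal_power_metric \<theta>) L"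
  let ?v = "dpm_dchart (2 - \<theta>) L (dpm_chart \<theta> K - dpm_chart \<theta> L)"
  have D: "X \<in> lower_triangular" "dpm_chart \<theta> L + dpm_dchart \<theta> L X \<in> dpm_image \<theta>" if "X \<in> ?D" for X
    using that dpm_geodesic_exp(1)[OF assms(1,2), of X] by (auto simp: exp_domain_def)
  show "inj_on (riem_exp lower_triangular cholesky (diagonal_power_metric \<theta>) L) ?D"
  proof (rule inj_onI)
    fix X Y assume X: "X \<in> ?D" and Y: "Y \<in> ?D"
      and "riem_exp lower_triangular cholesky (diagonal_power_metric \<theta>) L X =
        riem_exp lower_triangular cholesky (diagonal_power_metric \<theta>) L Y"
    then have "dpm_chart_inv \<theta> (dpm_chart \<theta> L + dpm_dchart \<theta> L X) =
        dpm_chart_inv \<theta> (dpm_chart \<theta> L + dpm_dchart \<theta> L Y)"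
      using D assms by (simp add: dpm_geodesic_exp)
    from arg_cong[OF this, of "dpm_chart \<theta>"] have "dpm_dchart \<theta> L X = dpm_dchart \<theta> L Y"
      using D X Y assms by (simp add: dpm_chart_chart_inv)
    from arg_cong[OF this, of "dpm_dchart (2 - \<theta>) L"] show "X = Y"
      using D X Y assms by (simp add: dpm_dchart_inverse)
  qed
  have "dpm_dchart \<theta> L ?v = dpm_chart \<theta> K - dpm_chart \<theta> L"
    using assms dpm_chart_in_image[OF assms(1,2)] dpm_chart_in_image[OF assms(1,3)]
    by (intro dpm_dchart_inverse)
       (auto simp: dpm_image_def subspace_lower_triangular intro: subspace_diff)
  then show "?v \<in> ?D" "riem_exp lower_triangular cholesky (diagonal_power_metric \<theta>) L ?v = K"
    using assms
    by (simp_all add: dpm_geodesic_exp dpm_dchart_lower_triangular dpm_chart_in_image dpm_chart_inv_chart)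
qed

lemma dpm_segment_in_image:
  assumes "\<theta> \<noteq> 0" "L \<in> cholesky" "K \<in> cholesky" "t \<in> {0..1}"
  shows "dpm_chart \<theta> L + t *\<^sub>R (dpm_chart \<theta> K - dpm_chart \<theta> L) \<in> dpm_image \<theta>"
  using convexD_alt[OF dpm_image_convex dpm_chart_in_image[OF assms(1,2)] dpm_chart_in_image[OF assms(1,3)]]
    assms(4) by (simp add: algebra_simps)

text \<open>The derivative is two-sided even at \<open>0\<close> and \<open>1\<close>, as
  \<open>speed\<close> and \<open>C1_differentiable_on\<close> require.\<close>

lemma dpm_segment_has_vector_derivative:
  assumes "\<theta> \<noteq> 0" "L \<in> cholesky" "K \<in> cholesky" "t \<in> {0..1}"
  defines "c \<equiv> \<lambda>t. dpm_chart_inv \<theta> (dpm_chart \<theta> L + t *\<^sub>R (dpm_chart \<theta> K - dpm_chart \<theta> L))"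
  shows "(c has_vector_derivative dpm_dchart (2 - \<theta>) (c t) (dpm_chart \<theta> K - dpm_chart \<theta> L)) (at t)"
  unfolding c_def using assms(1) dpm_segment_in_image[OF assms(1-4)]
  by (rule dpm_chart_inv_has_vector_derivative) (auto intro!: derivative_eq_intros)

section \<open>Parallel transport along the connecting geodesic\<close>

lemma at_within_Icc_neq_bot: "a < b \<Longrightarrow> t \<in> {a..b} \<Longrightarrow> at t within {a..b::real} \<noteq> bot"
  by (simp add: trivial_limit_within islimpt_Icc)

lemma dpm_parallel_transport:
  assumes "\<theta> \<noteq> 0" "L \<in> cholesky" "K \<in> cholesky" "X \<in> lower_triangular"
  shows "parallel_transport lower_triangular cholesky (diagonal_power_metric \<theta>) L K X =
    dpm_dchart (2 - \<theta>) K (dpm_dchart \<theta> L X)"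
proof -
  let ?U = "dpm_chart \<theta> K - dpm_chart \<theta> L"
  let ?\<gamma> = "\<lambda>t. dpm_chart_inv \<theta> (dpm_chart \<theta> L + t *\<^sub>R ?U)"
  define c where "c = (\<lambda>t. riem_exp lower_triangular cholesky (diagonal_power_metric \<theta>) L
    (t *\<^sub>R riem_log lower_triangular cholesky (diagonal_power_metric \<theta>) L K))"
  have "?U \<in> lower_triangular"
    using assms dpm_chart_in_image[OF assms(1,2)] dpm_chart_in_image[OF assms(1,3)]
    by (auto simp: dpm_image_def subspace_lower_triangular intro: subspace_diff)
  \<comment> \<open>In the chart the multiple \<open>t\<close> of the logarithm is
    \<open>t *\<^sub>R ?U\<close>, so convexity of the image keeps it in the exponential
    domain.\<close>
  then have c: "c t = ?\<gamma> t" if "t \<in> {0..1}" for t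
    unfolding c_def using assms dpm_segment_in_image[OF assms(1-3) that]
    by (subst dpm_geodesic_exp(2))
       (auto simp: dpm_riem_log dpm_dchart_linear dpm_dchart_inverse dpm_dchart_lower_triangular
         subspace_lower_triangular subspace_scale)
  have M: "c t \<in> cholesky" if "t \<in> {0..1}" for t
    unfolding c[OF that] using dpm_segment_in_image[OF assms(1-3) that]
    by (rule dpm_chart_inv_in_cholesky)
  \<comment> \<open>The curve is identified with the segment only on \<open>{0..1}\<close>, hence
    the derivative within that interval.\<close>
  have c': "(c has_vector_derivative dpm_dchart (2 - \<theta>) (c t) ?U) (at t within {0..1})"
    if "t \<in> {0..1}" for t
    unfolding c[OF that]
    by (rule has_vector_derivative_transform[OF that c
          has_vector_derivative_at_within[OF dpm_segment_has_vector_derivative[OF assms(1-3) that]]])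
  have ends: "c 0 = L" "c 1 = K"
    using assms by (simp_all add: c dpm_chart_inv_chart)
  show ?thesis
    unfolding parallel_transport_def c_def[symmetric] parallel_transport_along_def
  proof (rule the_equality)
    have "parallel_along lower_triangular cholesky (diagonal_power_metric \<theta>) {0..1} c
        (\<lambda>t. dpm_dchart (2 - \<theta>) (c t) (dpm_dchart \<theta> L X))"
      using M c' at_within_Icc_neq_bot[of 0 1] dpm_dchart_lower_triangular
      by (intro dpm_parallel_along_exists[where c' = "\<lambda>t. dpm_dchart (2 - \<theta>) (c t) ?U"] assms(1)) auto
    then show "\<exists>W. parallel_along lower_triangular cholesky (diagonal_power_metric \<theta>) {0..1} c W \<and>
        W 0 = X \<and> W 1 = dpm_dchart (2 - \<theta>) K (dpm_dchart \<theta> L X)"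
      using assms
      by (intro exI[of _ "\<lambda>t. dpm_dchart (2 - \<theta>) (c t) (dpm_dchart \<theta> L X)"] conjI)
         (simp_all add: ends dpm_dchart_inverse)
  next
    fix z
    assume "\<exists>W. parallel_along lower_triangular cholesky (diagonal_power_metric \<theta>) {0..1} c W \<and>
        W 0 = X \<and> W 1 = z"
    then obtain W where W: "parallel_along lower_triangular cholesky (diagonal_power_metric \<theta>) {0..1} c W"
      and "W 0 = X" "W 1 = z"
      by blast
    have "z \<in> lower_triangular"
      using W \<open>W 1 = z\<close> by (auto simp: parallel_along_def)
    moreover have "dpm_dchart \<theta> L X = dpm_dchart \<theta> K z"
      using dpm_parallel_along_constant[OF assms(1) W, of 0 1] \<open>W 0 = X\<close> \<open>W 1 = z\<close>
      by (simp add: at_within_Icc_neq_bot ends)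
    ultimately show "z = dpm_dchart (2 - \<theta>) K (dpm_dchart \<theta> L X)"
      using assms by (simp add: dpm_dchart_inverse)
  qed
qed

section \<open>Geodesic distance and weighted means\<close>

lemma continuous_on_dpm_chart:
  assumes "continuous_on S c" "\<And>t. t \<in> S \<Longrightarrow> c t \<in> cholesky"
  shows "continuous_on S (\<lambda>t. dpm_chart \<theta> (c t))"
proof -
  have "(\<lambda>t. dpm_chart \<theta> (c t)) = (\<lambda>t. \<chi> i j. if i = j then c t $ i $ i powr \<theta> / \<theta>
      else if j < i then c t $ i $ j else 0)"
    by (auto simp: vec_eq_iff dpm_nth)
  moreover have "continuous_on S (\<lambda>t. if i = j then c t $ i $ i powr \<theta> / \<theta>
      else if j < i then c t $ i $ j else 0)" for i j
    using assms choleskyD(1)[of "c _" i]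
    by (cases "i = j"; cases "j < i")
       (fastforce intro!: continuous_intros simp: divide_inverse)+
  ultimately show ?thesis
    by (simp only:) (intro continuous_on_vec_lambda)
qed

lemma dpm_speed:
  assumes "\<theta> \<noteq> 0" "c t \<in> cholesky"
  shows "speed (diagonal_power_metric \<theta>) c t = norm (dpm_dchart \<theta> (c t) (vector_derivative c (at t)))"
  using assms by (simp add: speed_def dpm_eq_inner choleskyD norm_eq_sqrt_inner)

text \<open>The speed is the norm of the derivative of the chart image, so this is the norm
  inequality for the integral of that derivative.\<close>

lemma dpm_length_ge:
  assumes "\<theta> \<noteq> 0" "valid_path c" "path_image c \<subseteq> cholesky"
    and "speed (diagonal_power_metric \<theta>) c integrable_on {0..1}"
  shows "norm (dpm_chart \<theta> (pathfinish c) - dpm_chart \<theta> (pathstart c)) \<le>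
    integral {0..1} (speed (diagonal_power_metric \<theta>) c)"
proof -
  let ?f' = "\<lambda>t. dpm_dchart \<theta> (c t) (vector_derivative c (at t))"
  have M: "c t \<in> cholesky" if "t \<in> {0..1}" for t
    using assms(3) that by (auto simp: path_image_def)
  obtain S where "finite S" and cont: "continuous_on {0..1} c" and S: "c C1_differentiable_on {0..1} - S"
    using assms(2) by (auto simp: valid_path_def piecewise_C1_differentiable_on_def)
  \<comment> \<open>The strong fundamental theorem admits finitely many exceptional points and
    yields integrability of the derivative, even if it is unbounded near them.\<close>
  have "(?f' has_integral dpm_chart \<theta> (c 1) - dpm_chart \<theta> (c 0)) {0..1}"
  proof (rule fundamental_theorem_of_calculus_strong[OF \<open>finite S\<close>])
    show "((\<lambda>t. dpm_chart \<theta> (c t)) has_vector_derivative ?f' t) (at t)" if "t \<in> {0..1} - S" for t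
      using S that M assms(1)
      by (intro dpm_chart_has_vector_derivative)
         (auto simp: C1_differentiable_on_eq vector_derivative_works)
    show "continuous_on {0..1} (\<lambda>t. dpm_chart \<theta> (c t))"
      using cont M by (rule continuous_on_dpm_chart)
  qed simp
  then have "?f' integrable_on {0..1}" "integral {0..1} ?f' = dpm_chart \<theta> (c 1) - dpm_chart \<theta> (c 0)"
    by (auto simp: integrable_on_def)
  moreover have "norm (?f' t) \<le> speed (diagonal_power_metric \<theta>) c t" if "t \<in> {0..1}" for t
    using dpm_speed[where c = c and t = t, OF assms(1) M[OF that]] by simp
  ultimately show ?thesis
    using integral_norm_bound_integral[of ?f', OF _ assms(4)]
    by (simp add: pathstart_def pathfinish_def)
qed

text \<open>The infimum is attained by the pulled-back segment, whose speed is constantly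
  \<open>norm ?U\<close>.\<close>

lemma dpm_riem_dist:
  assumes "\<theta> \<noteq> 0" "L \<in> cholesky" "K \<in> cholesky"
  shows "riem_dist cholesky (diagonal_power_metric \<theta>) L K = norm (dpm_chart \<theta> K - dpm_chart \<theta> L)"
  unfolding riem_dist_def
proof (rule cInf_eq_minimum)
  let ?U = "dpm_chart \<theta> K - dpm_chart \<theta> L"
  define c where "c = (\<lambda>t. dpm_chart_inv \<theta> (dpm_chart \<theta> L + t *\<^sub>R ?U))"
  let ?c' = "\<lambda>t. dpm_dchart (2 - \<theta>) (c t) ?U"
  have U: "?U \<in> lower_triangular"
    using assms dpm_chart_in_image[OF assms(1,2)] dpm_chart_in_image[OF assms(1,3)]
    by (auto simp: dpm_image_def subspace_lower_triangular intro: subspace_diff)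
  have M: "c t \<in> cholesky" if "t \<in> {0..1}" for t
    unfolding c_def using dpm_segment_in_image[OF assms that] by (rule dpm_chart_inv_in_cholesky)
  have c': "(c has_vector_derivative ?c' t) (at t)" if "t \<in> {0..1}" for t
    using dpm_segment_has_vector_derivative[OF assms that] by (simp add: c_def)
  \<comment> \<open>The velocity is itself differentiable, by the derivative rule with
    \<open>2 - \<theta>\<close> and the constant field \<open>?U\<close>.\<close>
  have "continuous_on {0..1} ?c'"
    by (rule continuous_on_vector_derivative,
        rule has_vector_derivative_at_within[OF
          dpm_dchart_has_vector_derivative[OF M c' has_vector_derivative_const]])
  then have "valid_path c"
    unfolding valid_path_def using c'
    by (auto intro!: C1_differentiable_imp_piecewise exI[of _ ?c'] simp: C1_differentiable_on_def)
  moreover have "path_image c \<subseteq> cholesky" "pathstart c = L" "pathfinish c = K"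
    using M assms by (auto simp: path_image_def pathstart_def pathfinish_def c_def dpm_chart_inv_chart)
  moreover have "(speed (diagonal_power_metric \<theta>) c has_integral norm ?U) {0..1}"
  proof -
    have "speed (diagonal_power_metric \<theta>) c t = norm ?U" if "t \<in> {0..1}" for t
      using dpm_speed[where c = c and t = t, OF assms(1) M[OF that]] vector_derivative_at[OF c'[OF that]] M[OF that] U
      by (simp add: dpm_dchart_inverse)
    then show ?thesis
      using has_integral_const_real[of "norm ?U" 0 1] by (subst has_integral_cong) auto
  qed
  ultimately show "norm ?U \<in> {integral {0..1} (speed (diagonal_power_metric \<theta>) c) | c.
      valid_path c \<and> path_image c \<subseteq> cholesky \<and> pathstart c = L \<and> pathfinish c = K \<and>
      speed (diagonal_power_metric \<theta>) c integrable_on {0..1}}"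
    by (auto intro!: exI[of _ c] simp: integral_unique has_integral_integrable)
qed (use assms(1) dpm_length_ge in auto)

text \<open>This is the parallel axis identity of Huygens and Steiner.\<close>

lemma weighted_variance_decomposition:
  fixes a :: "'i \<Rightarrow> 'a::real_inner" and w :: "'i \<Rightarrow> real"
  assumes "(\<Sum>i\<in>I. w i) = 1"
  defines "m \<equiv> \<Sum>i\<in>I. w i *\<^sub>R a i"
  shows "(\<Sum>i\<in>I. w i * (norm (a i - x))\<^sup>2) = (norm (x - m))\<^sup>2 + (\<Sum>i\<in>I. w i * (norm (a i - m))\<^sup>2)"
proof -
  \<comment> \<open>The cross term is arranged so that its sum is the inner product of
    \<open>m - x\<close> with \<open>m - m\<close>.\<close>
  have "w i * (norm (a i - x))\<^sup>2 =
      w i * (norm (x - m))\<^sup>2 + w i * (norm (a i - m))\<^sup>2 + 2 * ((m - x) \<bullet> (w i *\<^sub>R a i - w i *\<^sub>R m))" for i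
    by (simp add: power2_norm_eq_inner inner_diff_left inner_diff_right inner_commute algebra_simps)
  then have "(\<Sum>i\<in>I. w i * (norm (a i - x))\<^sup>2) =
      (\<Sum>i\<in>I. w i) * (norm (x - m))\<^sup>2 + (\<Sum>i\<in>I. w i * (norm (a i - m))\<^sup>2) +
      2 * ((m - x) \<bullet> ((\<Sum>i\<in>I. w i *\<^sub>R a i) - (\<Sum>i\<in>I. w i) *\<^sub>R m))"
    unfolding scaleR_sum_left sum_distrib_right
    by (simp add: sum.distrib flip: sum_distrib_left inner_sum_right sum_subtractf)
  then show ?thesis
    using assms by simp
qed

text \<open>Up to a constant, the objective is the squared chart distance to the arithmetic mean, so
  it is minimal exactly where that distance vanishes.\<close>

lemma dpm_weighted_frechet_mean:
  assumes "\<theta> \<noteq> 0" and Ls: "\<And>i. i \<in> {1..N} \<Longrightarrow> Ls i \<in> cholesky"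
    and w: "\<And>i. i \<in> {1..N} \<Longrightarrow> 0 < w i" "(\<Sum>i=1..N. w i) = 1"
  shows "weighted_frechet_mean cholesky (diagonal_power_metric \<theta>) N w Ls =
    dpm_chart_inv \<theta> (\<Sum>i=1..N. w i *\<^sub>R dpm_chart \<theta> (Ls i))"
proof -
  let ?m = "\<Sum>i=1..N. w i *\<^sub>R dpm_chart \<theta> (Ls i)"
  let ?F = "\<lambda>p. \<Sum>i=1..N. w i * (riem_dist cholesky (diagonal_power_metric \<theta>) p (Ls i))\<^sup>2"
  let ?C = "\<Sum>i=1..N. w i * (norm (dpm_chart \<theta> (Ls i) - ?m))\<^sup>2"
  have F: "?F p = (norm (dpm_chart \<theta> p - ?m))\<^sup>2 + ?C" if "p \<in> cholesky" for p
  proof -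
    have "?F p = (\<Sum>i=1..N. w i * (norm (dpm_chart \<theta> (Ls i) - dpm_chart \<theta> p))\<^sup>2)"
      using assms that by (intro sum.cong refl) (simp add: dpm_riem_dist)
    also have "\<dots> = (norm (dpm_chart \<theta> p - ?m))\<^sup>2 + ?C"
      using w(2) by (rule weighted_variance_decomposition)
    finally show ?thesis .
  qed
  \<comment> \<open>Convexity is essential here: it makes the arithmetic mean the chart value of an
    actual point.\<close>
  have m: "?m \<in> dpm_image \<theta>"
    using w Ls dpm_chart_in_image[OF assms(1)]
    by (intro convex_sum[OF _ dpm_image_convex]) (auto intro: less_imp_le)
  then have P: "dpm_chart_inv \<theta> ?m \<in> cholesky" and FP: "?F (dpm_chart_inv \<theta> ?m) = ?C"
    using F dpm_chart_inv_in_cholesky[OF m] assms(1) by (auto simp: dpm_chart_chart_inv)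
  show ?thesis
    unfolding weighted_frechet_mean_def
  proof (rule the_equality)
    show "is_arg_min ?F (\<lambda>p. p \<in> cholesky) (dpm_chart_inv \<theta> ?m)"
      unfolding is_arg_min_def FP using P F by (auto simp: not_less)
  next
    fix p assume "is_arg_min ?F (\<lambda>p. p \<in> cholesky) p"
    then have p: "p \<in> cholesky" and "?F p \<le> ?C"
      using P FP by (auto simp: is_arg_min_def not_less)
    then have "dpm_chart \<theta> p = ?m"
      using F[OF p] by simp
    then show "p = dpm_chart_inv \<theta> ?m"
      using dpm_chart_inv_chart[OF assms(1) p] by simp
  qed
qed

section \<open>The chart formulas in matrix notation\<close>

theorem theorem3p2:
  fixes \<theta> :: real
    and L K X Y :: "'n::{finite,linorder} sq_matrix"
    and N :: nat and w :: "nat \<Rightarrow> real" and Ls :: "nat \<Rightarrow> 'n sq_matrix"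
  assumes "\<theta> \<noteq> 0"
    and "L \<in> cholesky" and "K \<in> cholesky"
    and "X \<in> lower_triangular" and "Y \<in> lower_triangular"
    and "\<And>i. i \<in> {1..N} \<Longrightarrow> Ls i \<in> cholesky"
    and "\<And>i. i \<in> {1..N} \<Longrightarrow> 0 < w i"
    and "(\<Sum>i=1..N. w i) = 1"
  shows
    "(diagonal_power_metric \<theta> L X Y =
       strict_lower X \<bullet> strict_lower Y +
       (diag_powr (diag_part L) (\<theta> - 1) ** diag_part X) \<bullet>
       (diag_powr (diag_part L) (\<theta> - 1) ** diag_part Y)) \<and>
     (maximal_geodesic lower_triangular cholesky (diagonal_power_metric \<theta>) L X
       {t. diag_part L + (t * \<theta>) *\<^sub>R diag_part X \<in> pos_diagonal}
       (\<lambda>t. strict_lower L + t *\<^sub>R strict_lower X +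
            diag_part L **
              diag_powr (mat 1 + (t * \<theta>) *\<^sub>R (matrix_inv (diag_part L) ** diag_part X)) (1 / \<theta>))) \<and>
     (riem_log lower_triangular cholesky (diagonal_power_metric \<theta>) L K =
       strict_lower K - strict_lower L +
       (1 / \<theta>) *\<^sub>R
         (diag_part L ** (diag_powr (matrix_inv (diag_part L) ** diag_part K) \<theta> - mat 1))) \<and>
     (parallel_transport lower_triangular cholesky (diagonal_power_metric \<theta>) L K X =
       strict_lower X +
       diag_powr (matrix_inv (diag_part L) ** diag_part K) (1 - \<theta>) ** diag_part X) \<and>
     ((riem_dist cholesky (diagonal_power_metric \<theta>) L K)\<^sup>2 =
       (norm (strict_lower K - strict_lower L))\<^sup>2 +
       1 / \<theta>\<^sup>2 * (norm (diag_powr (diag_part K) \<theta> - diag_powr (diag_part L) \<theta>))\<^sup>2) \<and>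
     (weighted_frechet_mean cholesky (diagonal_power_metric \<theta>) N w Ls =
       (\<Sum>i=1..N. w i *\<^sub>R strict_lower (Ls i)) +
       diag_powr (\<Sum>i=1..N. w i *\<^sub>R diag_powr (diag_part (Ls i)) \<theta>) (1 / \<theta>))"
proof (intro conjI)
  have pos: "0 < L $ i $ i" "0 < K $ i $ i" for i
    using assms choleskyD by auto
  have inv: "matrix_inv (diag_part L) = diag_part (\<chi> i j. inverse (L $ i $ j))"
    using pos by (intro matrix_inv_diag_part) (simp add: less_imp_neq[symmetric])
  show "diagonal_power_metric \<theta> L X Y =
       strict_lower X \<bullet> strict_lower Y +
       (diag_powr (diag_part L) (\<theta> - 1) ** diag_part X) \<bullet>
       (diag_powr (diag_part L) (\<theta> - 1) ** diag_part Y)"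
    using assms(1) pos
    by (simp add: dpm_eq_inner dpm_dchart_def inner_add strict_lower_inner_diag inner_commute
        diag_powr_diag_part)
  show "maximal_geodesic lower_triangular cholesky (diagonal_power_metric \<theta>) L X
       {t. diag_part L + (t * \<theta>) *\<^sub>R diag_part X \<in> pos_diagonal}
       (\<lambda>t. strict_lower L + t *\<^sub>R strict_lower X +
            diag_part L **
              diag_powr (mat 1 + (t * \<theta>) *\<^sub>R (matrix_inv (diag_part L) ** diag_part X)) (1 / \<theta>))"
    (is "maximal_geodesic _ _ _ _ _ ?I ?c")
  proof (rule dpm_maximal_geodesic)
    let ?b = "\<lambda>t. dpm_chart \<theta> L + t *\<^sub>R dpm_dchart \<theta> L X"
    \<comment> \<open>Factoring out \<open>L $ i $ i powr \<theta>\<close> reduces membership in the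
      image to positivity of the bracket and brings the factor \<open>L $ i $ i\<close> out of the
      root.\<close>
    have b: "\<theta> * ?b t $ i $ i = L $ i $ i powr \<theta> * (1 + t * \<theta> * (X $ i $ i / L $ i $ i))" for t i
      using pos[of i] assms(1) by (simp add: dpm_nth powr_diff field_simps)
    have I: "t \<in> ?I \<longleftrightarrow> (\<forall>i. 0 < 1 + t * \<theta> * (X $ i $ i / L $ i $ i))" for t
    proof -
      have "0 < L $ i $ i + t * \<theta> * X $ i $ i \<longleftrightarrow> 0 < 1 + t * \<theta> * (X $ i $ i / L $ i $ i)" for i
        using pos[of i] by (simp add: field_simps)
      then show ?thesis
        by (simp add: pos_diagonal_def diag_nth)
    qed
    show "?I = {t. ?b t \<in> dpm_image \<theta>}"
    proof (rule set_eqI)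
      fix t
      have "?b t \<in> lower_triangular"
        by (auto simp: lower_triangular_def dpm_nth)
      moreover have "0 < \<theta> * ?b t $ i $ i \<longleftrightarrow> 0 < 1 + t * \<theta> * (X $ i $ i / L $ i $ i)" for i
        using pos[of i] unfolding b by (simp add: zero_less_mult_iff)
      ultimately show "t \<in> ?I \<longleftrightarrow> t \<in> {t. ?b t \<in> dpm_image \<theta>}"
        unfolding I by (simp add: dpm_image_def)
    qed
    fix t assume "t \<in> ?I"
    then have t: "0 < 1 + t * \<theta> * (X $ i $ i / L $ i $ i)" for i
      unfolding I by blast
    have "?c t $ i $ j = dpm_chart_inv \<theta> (?b t) $ i $ j" for i j
    proof (cases "i = j")
      case True
      then have "?c t $ i $ j = L $ i $ i * (1 + t * \<theta> * (X $ i $ i / L $ i $ i)) powr (1 / \<theta>)"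
        by (simp add: inv diag_nth mat_def field_simps)
      also have "\<dots> = (\<theta> * ?b t $ i $ i) powr (1 / \<theta>)"
        unfolding b using t[of i] pos[of i] assms(1)
        by (simp add: powr_mult powr_powr less_imp_le)
      finally show ?thesis
        using True by (simp add: dpm_chart_inv_nth)
    qed (auto simp: dpm_nth diag_nth)
    then show "?c t = dpm_chart_inv \<theta> (?b t)"
      by (simp add: vec_eq_iff)
  qed (use assms in auto)
  have quotient_powr: "(inverse (L $ i $ i) * K $ i $ i) powr a = K $ i $ i powr a * L $ i $ i powr - a" for i a
    using pos[of i] by (simp add: powr_mult inverse_powr powr_minus)
  show "riem_log lower_triangular cholesky (diagonal_power_metric \<theta>) L K =
       strict_lower K - strict_lower L +
       (1 / \<theta>) *\<^sub>R
         (diag_part L ** (diag_powr (matrix_inv (diag_part L) ** diag_part K) \<theta> - mat 1))"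
  proof -
    let ?lhs = "dpm_dchart (2 - \<theta>) L (dpm_chart \<theta> K - dpm_chart \<theta> L)"
    let ?rhs = "strict_lower K - strict_lower L + (1 / \<theta>) *\<^sub>R
      (diag_part L ** (diag_powr (matrix_inv (diag_part L) ** diag_part K) \<theta> - mat 1))"
    have "?lhs $ i $ j = ?rhs $ i $ j" for i j
    proof (cases "i = j")
      case True
      \<comment> \<open>Splitting off one factor \<open>L $ i $ i\<close> leaves the power
        \<open>- \<theta>\<close>, which turns the difference of powers into a power of the quotient
        minus one.\<close>
      have 2: "L $ i $ i powr (1 - \<theta>) = L $ i $ i * L $ i $ i powr - \<theta>"
        and 1: "L $ i $ i powr - \<theta> * L $ i $ i powr \<theta> = 1"
        using pos[of i] powr_add[of "L $ i $ i" 1 "- \<theta>"] by (simp_all flip: powr_add)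
      have "?lhs $ i $ j = L $ i $ i powr (1 - \<theta>) * (K $ i $ i powr \<theta> / \<theta> - L $ i $ i powr \<theta> / \<theta>)"
        using True by (simp add: dpm_nth)
      also have "\<dots> = 1 / \<theta> * (L $ i $ i * (K $ i $ i powr \<theta> * L $ i $ i powr - \<theta> -
            L $ i $ i powr - \<theta> * L $ i $ i powr \<theta>))"
        unfolding 2 by (simp add: algebra_simps diff_divide_distrib)
      also have "\<dots> = 1 / \<theta> * (L $ i $ i * ((inverse (L $ i $ i) * K $ i $ i) powr \<theta> - 1))"
        unfolding 1 quotient_powr ..
      also have "\<dots> = ?rhs $ i $ j"
        using True by (simp add: inv diag_nth mat_def)
      finally show ?thesis .
    qed (auto simp: dpm_nth diag_nth mat_def)
    then show ?thesis
      unfolding dpm_riem_log[OF assms(1-3)] unfolding vec_eq_iff by blast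
  qed
  show "parallel_transport lower_triangular cholesky (diagonal_power_metric \<theta>) L K X =
       strict_lower X +
       diag_powr (matrix_inv (diag_part L) ** diag_part K) (1 - \<theta>) ** diag_part X"
  proof -
    have "dpm_dchart (2 - \<theta>) K (dpm_dchart \<theta> L X) $ i $ j = (strict_lower X +
        diag_powr (matrix_inv (diag_part L) ** diag_part K) (1 - \<theta>) ** diag_part X) $ i $ j" for i j
    proof (cases "i = j")
      case True
      have "K $ i $ i powr (1 - \<theta>) * (L $ i $ i powr (\<theta> - 1) * X $ i $ i) =
          (inverse (L $ i $ i) * K $ i $ i) powr (1 - \<theta>) * X $ i $ i"
        unfolding quotient_powr by simp
      then show ?thesis
        using True by (simp add: dpm_nth diag_nth inv)
    qed (auto simp: dpm_nth diag_nth)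
    then show ?thesis
      unfolding dpm_parallel_transport[OF assms(1-4)] unfolding vec_eq_iff by blast
  qed
  show "(riem_dist cholesky (diagonal_power_metric \<theta>) L K)\<^sup>2 =
       (norm (strict_lower K - strict_lower L))\<^sup>2 +
       1 / \<theta>\<^sup>2 * (norm (diag_powr (diag_part K) \<theta> - diag_powr (diag_part L) \<theta>))\<^sup>2"
  proof -
    let ?S = "strict_lower K - strict_lower L"
    let ?D = "diag_powr (diag_part K) \<theta> - diag_powr (diag_part L) \<theta>"
    have "dpm_chart \<theta> K - dpm_chart \<theta> L = ?S + (1 / \<theta>) *\<^sub>R ?D"
      by (simp add: dpm_chart_def diag_powr_diag_part algebra_simps)
    \<comment> \<open>Orthogonality removes the mixed term from the squared norm.\<close>
    moreover have "?S \<bullet> ?D = 0"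
      by (simp add: inner_diff strict_lower_inner_diag)
    ultimately show ?thesis
      using assms norm_add_Pythagorean[of ?S "(1 / \<theta>) *\<^sub>R ?D"]
      by (simp add: dpm_riem_dist orthogonal_def power_divide)
  qed
  show "weighted_frechet_mean cholesky (diagonal_power_metric \<theta>) N w Ls =
       (\<Sum>i=1..N. w i *\<^sub>R strict_lower (Ls i)) +
       diag_powr (\<Sum>i=1..N. w i *\<^sub>R diag_powr (diag_part (Ls i)) \<theta>) (1 / \<theta>)"
  proof -
    have "weighted_frechet_mean cholesky (diagonal_power_metric \<theta>) N w Ls =
        dpm_chart_inv \<theta> (\<Sum>i=1..N. w i *\<^sub>R dpm_chart \<theta> (Ls i))"
      using assms by (intro dpm_weighted_frechet_mean) auto
    \<comment> \<open>The multiplication by \<open>\<theta>\<close> inside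
      \<open>dpm_chart_inv\<close> cancels the factor \<open>1 / \<theta>\<close> of every chart
      value.\<close>
    then show ?thesis
      using assms(1) by (simp add: vec_eq_iff dpm_nth diag_nth sum_distrib_left)
  qed
qed

end
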